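(* Let $\mathbb E$ be a finite-dimensional Euclidean space, let $S\subset U\subset\mathbb E$ be nonempty, let $T:U\rightrightarrows\mathbb E$ be a set-valued mapping, and let $\varepsilon\ge0$. The following are equivalent. (i) $T$ is pointwise almost firmly nonexpansive on $U$ at all $y\in S$ with violation $\varepsilon$. (ii) The mapping $\tilde T:U\rightrightarrows\mathbb E$, $\tilde Tx:=2Tx-x$ for $x\in U$, is pointwise almost nonexpansive on $U$ at all $y\in S$ with violation $2\varepsilon$; that is, $T$ can be written as $Tx=\frac12(x+\tilde Tx)$ for all $x\in U$ with such a $\tilde T$. (iii) $\|x^+-y^+\|^2\le\frac\varepsilon2\|x-y\|^2+\langle x^+-y^+,x-y\rangle$ for all $x^+\in Tx$ and all $y^+\in Ty$, at each $y\in S$, whenever $x\in U$. (iv) Let $F:\mathbb E\rightrightarrows\mathbb E$ be a mapping whose resolvent is $T$, i.e. $T=(\mathrm{Id}+F)^{-1}$ (on $U$). At each $x\in U$, for all $u\in Tx$, $y\in S$ and $v\in Ty$, the points $(u,z)$ and $(v,w)$ are in $\operatorname{gph}F$, where $z=x-u$ and $w=y-v$, and satisfy $$-\frac\varepsilon2\|(u+z)-(v+w)\|^2\le\langle z-w,u-v\rangle .$$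
   Context: A set-valued mapping $T$ is pointwise almost nonexpansive on $U$ at $y\in U$ with violation $\varepsilon\ge0$ if $\|x^+-y^+\|\le\sqrt{1+\varepsilon}\,\|x-y\|$ for all $y^+\in Ty$ and all $x^+\in Tx$, $x\in U$. $T$ is pointwise almost averaged on $U$ at $y$ with averaging constant $\alpha\in(0,1)$ and violation $\varepsilon$ if the mapping $\tilde T=(1-\frac1\alpha)\mathrm{Id}+\frac1\alpha T$ (so that $T=(1-\alpha)\mathrm{Id}+\alpha\tilde T$) is pointwise almost nonexpansive on $U$ at $y$ with violation $\varepsilon/\alpha$; equivalently, $\|x^+-y^+\|^2\le(1+\varepsilon)\|x-y\|^2-\frac{1-\alpha}{\alpha}\|(x-x^+)-(y-y^+)\|^2$ for all $x\in U$, $x^+\in Tx$, $y^+\in Ty$. "Pointwise almost firmly nonexpansive" is the case $\alpha=1/2$. $(\mathrm{Id}+F)^{-1}(x)=\{u: x-u\in F(u)\}$. *)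

theory Defs
  imports "HOL-Analysis.Analysis"
begin

text \<open>
  A set-valued mapping from \<open>U\<close> to subsets of \<open>'a\<close> is a function \<open>'a \<Rightarrow> 'a set\<close>
  of which only the values at points of \<open>U\<close> matter; values may be empty.
\<close>

definition pointwise_almost_nonexpansive ::
  "'a::euclidean_space set \<Rightarrow> ('a \<Rightarrow> 'a set) \<Rightarrow> real \<Rightarrow> 'a \<Rightarrow> bool" where
  "pointwise_almost_nonexpansive U T \<epsilon> y \<longleftrightarrow>
     y \<in> U \<and> 0 \<le> \<epsilon> \<and>
     (\<forall>y'\<in>T y. \<forall>x\<in>U. \<forall>x'\<in>T x. norm (x' - y') \<le> sqrt (1 + \<epsilon>) * norm (x - y))"

text \<open>For \<open>\<alpha> \<noteq> 0\<close>, the unique mapping \<open>T'\<close> with \<open>T = (1 - \<alpha>) Id + \<alpha> T'\<close>.\<close>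

definition unaveraged :: "real \<Rightarrow> ('a::euclidean_space \<Rightarrow> 'a set) \<Rightarrow> 'a \<Rightarrow> 'a set" where
  "unaveraged \<alpha> T x = (\<lambda>u. (1 - 1 / \<alpha>) *\<^sub>R x + (1 / \<alpha>) *\<^sub>R u) ` T x"

definition pointwise_almost_averaged ::
  "'a::euclidean_space set \<Rightarrow> ('a \<Rightarrow> 'a set) \<Rightarrow> real \<Rightarrow> real \<Rightarrow> 'a \<Rightarrow> bool" where
  "pointwise_almost_averaged U T \<alpha> \<epsilon> y \<longleftrightarrow>
     0 < \<alpha> \<and> \<alpha> < 1 \<and> pointwise_almost_nonexpansive U (unaveraged \<alpha> T) (\<epsilon> / \<alpha>) y"

definition pointwise_almost_firmly_nonexpansive ::
  "'a::euclidean_space set \<Rightarrow> ('a \<Rightarrow> 'a set) \<Rightarrow> real \<Rightarrow> 'a \<Rightarrow> bool" where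
  "pointwise_almost_firmly_nonexpansive U T \<epsilon> y \<longleftrightarrow> pointwise_almost_averaged U T (1 / 2) \<epsilon> y"

definition gph :: "('a \<Rightarrow> 'b set) \<Rightarrow> ('a \<times> 'b) set" where
  "gph F = {(u, z). z \<in> F u}"

text \<open>The resolvent \<open>(Id + F)\<inverse>\<close>: \<open>u\<close> is a value at \<open>x\<close> iff \<open>x \<in> u + F u\<close>.\<close>

definition resolvent :: "('a::euclidean_space \<Rightarrow> 'a set) \<Rightarrow> 'a \<Rightarrow> 'a set" where
  "resolvent F x = {u. x - u \<in> F u}"

definition resolvent_on :: "'a::euclidean_space set \<Rightarrow> ('a \<Rightarrow> 'a set) \<Rightarrow> ('a \<Rightarrow> 'a set) \<Rightarrow> bool" where
  "resolvent_on U F T \<longleftrightarrow> (\<forall>x\<in>U. T x = resolvent F x)"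

end

theory Submission
  imports Defs
begin

text \<open>
  With \<open>d = x - y\<close> and \<open>e = x' - y'\<close>, expanding \<open>(norm (2 *\<^sub>R e - d))\<^sup>2\<close> turns (ii) into (iii), while
  \<open>(z - w) \<bullet> (u - v) = e \<bullet> d - (norm e)\<^sup>2\<close> turns (iv) into (iii). Every \<open>T\<close> is the resolvent
  of the mapping with values \<open>{z. u \<in> T (u + z)}\<close>, so neither quantification over \<open>F\<close> in (iv) is vacuous.
\<close>

text \<open>Both sides of the norm bound are nonnegative, so it may be squared. The term
  \<open>(norm d)\<^sup>2\<close> of the expansion then cancels the \<open>1\<close> in
  \<open>1 + 2 * \<epsilon>\<close>, and division by 4 turns \<open>2 * \<epsilon>\<close> into
  \<open>\<epsilon> / 2\<close>.\<close>

lemma norm_reflection_le_iff: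
  fixes d e :: "'a::real_inner"
  assumes "0 \<le> \<epsilon>"
  shows "norm (2 *\<^sub>R e - d) \<le> sqrt (1 + 2 * \<epsilon>) * norm d \<longleftrightarrow>
    (norm e)\<^sup>2 \<le> \<epsilon> / 2 * (norm d)\<^sup>2 + e \<bullet> d"
proof -
  have "norm (2 *\<^sub>R e - d) \<le> sqrt (1 + 2 * \<epsilon>) * norm d \<longleftrightarrow>
      (norm (2 *\<^sub>R e - d))\<^sup>2 \<le> (sqrt (1 + 2 * \<epsilon>) * norm d)\<^sup>2"
    using assms by (simp add: power_mono_iff)
  also have "(sqrt (1 + 2 * \<epsilon>) * norm d)\<^sup>2 = (1 + 2 * \<epsilon>) * (norm d)\<^sup>2"
    using assms by (simp add: power_mult_distrib)
  also have "(norm (2 *\<^sub>R e - d))\<^sup>2 = 4 * (norm e)\<^sup>2 - 4 * (e \<bullet> d) + (norm d)\<^sup>2"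
    by (simp add: power2_norm_eq_inner inner_diff_left inner_diff_right inner_commute[of d e])
  finally show ?thesis
    by (simp add: algebra_simps) linarith
qed

text \<open>At \<alpha> = 1/2 the coefficients \<open>1 - 1 / \<alpha>\<close> and
  \<open>1 / \<alpha>\<close> are -1 and 2, and the violation \<open>\<epsilon> / \<alpha>\<close>
  is \<open>2 * \<epsilon>\<close>.\<close>

lemma pointwise_almost_firmly_nonexpansive_iff_reflection:
  "pointwise_almost_firmly_nonexpansive U T \<epsilon> y \<longleftrightarrow>
    pointwise_almost_nonexpansive U (\<lambda>x. (\<lambda>u. 2 *\<^sub>R u - x) ` T x) (2 * \<epsilon>) y"
proof -
  have "unaveraged (1 / 2) T = (\<lambda>x. (\<lambda>u. 2 *\<^sub>R u - x) ` T x)"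
    by (simp add: unaveraged_def fun_eq_iff)
  then show ?thesis
    by (simp add: pointwise_almost_firmly_nonexpansive_def pointwise_almost_averaged_def mult.commute)
qed

text \<open>The difference of two reflected values is \<open>2 *\<^sub>R e - d\<close>, so the norm
  equivalence applies to each pair of values. The two hypotheses settle the side conditions in the
  definition of almost nonexpansiveness.\<close>

lemma pointwise_almost_nonexpansive_reflection_iff:
  assumes "y \<in> U" and "0 \<le> \<epsilon>"
  shows "pointwise_almost_nonexpansive U (\<lambda>x. (\<lambda>u. 2 *\<^sub>R u - x) ` T x) (2 * \<epsilon>) y \<longleftrightarrow>
    (\<forall>x\<in>U. \<forall>x'\<in>T x. \<forall>y'\<in>T y.
      (norm (x' - y'))\<^sup>2 \<le> \<epsilon> / 2 * (norm (x - y))\<^sup>2 + (x' - y') \<bullet> (x - y))"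
proof -
  have "norm ((2 *\<^sub>R x' - x) - (2 *\<^sub>R y' - y)) \<le> sqrt (1 + 2 * \<epsilon>) * norm (x - y) \<longleftrightarrow>
      (norm (x' - y'))\<^sup>2 \<le> \<epsilon> / 2 * (norm (x - y))\<^sup>2 + (x' - y') \<bullet> (x - y)" for x x' y' :: 'a
  proof -
    have "(2 *\<^sub>R x' - x) - (2 *\<^sub>R y' - y) = 2 *\<^sub>R (x' - y') - (x - y)"
      by (simp add: scaleR_diff_right)
    then show ?thesis
      using norm_reflection_le_iff[OF assms(2)] by metis
  qed
  then show ?thesis
    unfolding pointwise_almost_nonexpansive_def ball_simps
    using assms by simp blast
qed

text \<open>The definition includes \<open>y \<in> U\<close>, so agreement on \<open>U\<close> also
  covers the value at \<open>y\<close>.\<close>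

lemma pointwise_almost_nonexpansive_cong:
  assumes "\<And>x. x \<in> U \<Longrightarrow> T x = T' x"
  shows "pointwise_almost_nonexpansive U T \<epsilon> y \<longleftrightarrow> pointwise_almost_nonexpansive U T' \<epsilon> y"
  using assms unfolding pointwise_almost_nonexpansive_def by auto

text \<open>For fixed \<open>x\<close> the two maps are mutually inverse, so taking images under
  them is invertible too.\<close>

lemma midpoint_image_iff_reflection_image:
  fixes x :: "'a::real_vector"
  shows "A = (\<lambda>u. (1 / 2) *\<^sub>R (x + u)) ` B \<longleftrightarrow> B = (\<lambda>u. 2 *\<^sub>R u - x) ` A"
proof -
  have "(\<lambda>u. 2 *\<^sub>R u - x) ` (\<lambda>u. (1 / 2) *\<^sub>R (x + u)) ` C = C"
    and "(\<lambda>u. (1 / 2) *\<^sub>R (x + u)) ` (\<lambda>u. 2 *\<^sub>R u - x) ` C = C" for C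
    by (simp_all add: image_image)
  then show ?thesis
    by metis
qed

lemma ex_resolvent_on: "\<exists>F. resolvent_on U F T"
  by (rule exI[of _ "\<lambda>u. {z. u \<in> T (u + z)}"]) (simp add: resolvent_on_def resolvent_def)

text \<open>This makes the graph memberships in (iv) automatic, leaving only the inequality.\<close>

lemma resolvent_on_imp_gph:
  assumes "resolvent_on U F T" and "x \<in> U" and "u \<in> T x"
  shows "(u, x - u) \<in> gph F"
  using assms by (auto simp: resolvent_on_def resolvent_def gph_def)

text \<open>The sums \<open>u + z\<close> and \<open>v + w\<close> collapse to \<open>x\<close> and
  \<open>y\<close>; what remains is to move \<open>(norm (u - v))\<^sup>2\<close> to the other
  side.\<close>

lemma almost_monotone_iff:
  fixes x y u v :: "'a::real_inner"
  shows "- (\<epsilon> / 2) * (norm ((u + (x - u)) - (v + (y - v))))\<^sup>2 \<le> ((x - u) - (y - v)) \<bullet> (u - v) \<longleftrightarrow>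
    (norm (u - v))\<^sup>2 \<le> \<epsilon> / 2 * (norm (x - y))\<^sup>2 + (u - v) \<bullet> (x - y)"
proof -
  have "((x - u) - (y - v)) \<bullet> (u - v) = (u - v) \<bullet> (x - y) - (norm (u - v))\<^sup>2"
    by (simp add: power2_norm_eq_inner algebra_simps inner_commute)
  then show ?thesis
    by simp linarith
qed

theorem proposition2p3:
  fixes U S :: "'a::euclidean_space set"
    and T :: "'a \<Rightarrow> 'a set"
    and \<epsilon> :: real
  assumes "S \<noteq> {}" and "S \<subseteq> U" and "0 \<le> \<epsilon>"
  shows
    "let
       i = (\<forall>y\<in>S. pointwise_almost_firmly_nonexpansive U T \<epsilon> y);
       ii = (\<forall>y\<in>S. pointwise_almost_nonexpansive U (\<lambda>x. (\<lambda>u. 2 *\<^sub>R u - x) ` T x) (2 * \<epsilon>) y);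
       ii' = (\<exists>T'. (\<forall>x\<in>U. T x = (\<lambda>u. (1 / 2) *\<^sub>R (x + u)) ` T' x) \<and>
                   (\<forall>y\<in>S. pointwise_almost_nonexpansive U T' (2 * \<epsilon>) y));
       iii = (\<forall>y\<in>S. \<forall>x\<in>U. \<forall>x'\<in>T x. \<forall>y'\<in>T y.
                (norm (x' - y'))\<^sup>2 \<le> \<epsilon> / 2 * (norm (x - y))\<^sup>2 + (x' - y') \<bullet> (x - y));
       iv = (\<lambda>F. \<forall>x\<in>U. \<forall>u\<in>T x. \<forall>y\<in>S. \<forall>v\<in>T y.
                let z = x - u; w = y - v in
                  (u, z) \<in> gph F \<and> (v, w) \<in> gph F \<and>
                  - (\<epsilon> / 2) * (norm ((u + z) - (v + w)))\<^sup>2 \<le> (z - w) \<bullet> (u - v))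
     in
       (i \<longleftrightarrow> ii) \<and> (i \<longleftrightarrow> ii') \<and> (i \<longleftrightarrow> iii) \<and>
       (i \<longleftrightarrow> (\<forall>F. resolvent_on U F T \<longrightarrow> iv F)) \<and>
       (i \<longleftrightarrow> (\<exists>F. resolvent_on U F T \<and> iv F))"
proof -
  define i where "i \<longleftrightarrow> (\<forall>y\<in>S. pointwise_almost_firmly_nonexpansive U T \<epsilon> y)"
  define ii where "ii \<longleftrightarrow>
    (\<forall>y\<in>S. pointwise_almost_nonexpansive U (\<lambda>x. (\<lambda>u. 2 *\<^sub>R u - x) ` T x) (2 * \<epsilon>) y)"
  define ii' where "ii' \<longleftrightarrow> (\<exists>T'. (\<forall>x\<in>U. T x = (\<lambda>u. (1 / 2) *\<^sub>R (x + u)) ` T' x) \<and>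
    (\<forall>y\<in>S. pointwise_almost_nonexpansive U T' (2 * \<epsilon>) y))"
  define iii where "iii \<longleftrightarrow> (\<forall>y\<in>S. \<forall>x\<in>U. \<forall>x'\<in>T x. \<forall>y'\<in>T y.
    (norm (x' - y'))\<^sup>2 \<le> \<epsilon> / 2 * (norm (x - y))\<^sup>2 + (x' - y') \<bullet> (x - y))"
  define iv where "iv F \<longleftrightarrow> (\<forall>x\<in>U. \<forall>u\<in>T x. \<forall>y\<in>S. \<forall>v\<in>T y.
    let z = x - u; w = y - v in
      (u, z) \<in> gph F \<and> (v, w) \<in> gph F \<and>
      - (\<epsilon> / 2) * (norm ((u + z) - (v + w)))\<^sup>2 \<le> (z - w) \<bullet> (u - v))" for F
  have "i \<longleftrightarrow> ii"
    by (simp add: i_def ii_def pointwise_almost_firmly_nonexpansive_iff_reflection)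
  moreover have "ii \<longleftrightarrow> ii'"
  proof
    assume ii
    then show ii'
      unfolding ii_def ii'_def midpoint_image_iff_reflection_image
      \<comment> \<open>The rewritten constraint prescribes \<open>T'\<close> on \<open>U\<close> as
        the reflection of \<open>T\<close>, so the reflection itself is the witness.\<close>
      by (intro exI[of _ "\<lambda>x. (\<lambda>u. 2 *\<^sub>R u - x) ` T x"]) simp
  next
    assume ii'
    then obtain T' where "\<And>x. x \<in> U \<Longrightarrow> T' x = (\<lambda>u. 2 *\<^sub>R u - x) ` T x"
      and "\<forall>y\<in>S. pointwise_almost_nonexpansive U T' (2 * \<epsilon>) y"
      unfolding ii'_def midpoint_image_iff_reflection_image by blast
    then show ii
      unfolding ii_def by (simp cong: pointwise_almost_nonexpansive_cong)
  qed
  moreover have "ii \<longleftrightarrow> iii"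
    unfolding ii_def iii_def using assms
    by (intro ball_cong refl pointwise_almost_nonexpansive_reflection_iff) auto
  moreover have iii_iff_iv: "iii \<longleftrightarrow> iv F" if "resolvent_on U F T" for F
    unfolding iii_def iv_def Let_def almost_monotone_iff
    \<comment> \<open>Since \<open>S\<close> lies in \<open>U\<close>, the graph membership is
      available at \<open>y\<close> as well as at \<open>x\<close>.\<close>
    using \<open>S \<subseteq> U\<close> resolvent_on_imp_gph[OF that] by blast
  \<comment> \<open>As (iii) does not mention \<open>F\<close>, a single resolvent representation
    suffices to pass from the universal form of (iv) back to (iii), and from (iii) to the
    existential form.\<close>
  moreover obtain F where "resolvent_on U F T"
    using ex_resolvent_on by blast
  ultimately have "(i \<longleftrightarrow> ii) \<and> (i \<longleftrightarrow> ii') \<and> (i \<longleftrightarrow> iii) \<and>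
      (i \<longleftrightarrow> (\<forall>F. resolvent_on U F T \<longrightarrow> iv F)) \<and> (i \<longleftrightarrow> (\<exists>F. resolvent_on U F T \<and> iv F))"
    by blast
  then show ?thesis
    unfolding Let_def i_def ii_def ii'_def iii_def iv_def .
qed

end
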